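(* Let $p,m\in\mathbb{N}$, let $g\in\mathcal{D}^p\cap\mathcal{K}^{p+m}$, and let $f\colon\mathbb{R}_+\to\mathbb{R}$ be a solution to the equation $\Delta^{m+1}f=g$ on $\mathbb{R}_+$. Then $\Delta^kf\in\mathcal{K}^{p+m}$ for all $k=0,1,\ldots,m$ if and only if $$f=P_m+\Sigma^{m+1}g$$ for some polynomial $P_m$ of degree at most $m$. In particular, $\Sigma^{m+1}g$ is the unique solution $f\colon\mathbb{R}_+\to\mathbb{R}$ to the equation $\Delta^{m+1}f=g$ for which $\Delta^kf\in\mathcal{K}^{p+m}$ and $f(k+1)=0$ for $k=0,1,\ldots,m$.
   Context: $\mathbb{N}$ is the set of nonnegative integers, $\mathbb{R}_+=(0,\infty)$, $\Delta f(x)=f(x+1)-f(x)$, and $\binom{x}{j}=x(x-1)\cdots(x-j+1)/j!$ for real $x$ and $j\in\mathbb{N}$. For an integer $p\ge -1$, a function $f$ on a real interval $I$ is $p$-convex if its divided difference $f[x_0,\dots,x_{p+1}]$ is $\ge 0$ at any $p+2$ pairwise distinct points of $I$, and $p$-concave if $-f$ is $p$-convex. For $p\in\mathbb{N}$, $\mathcal{D}^p$ is the set of functions $f\colon\mathbb{R}_+\to\mathbb{R}$ such that $\Delta^pf(n)\to0$ as the integer $n\to\infty$. For an integer $p\ge-1$, $\mathcal{K}^p$ is the set of functions $f\colon\mathbb{R}_+\to\mathbb{R}$ that are eventually $p$-convex or eventually $p$-concave (i.e. $p$-convex, or $p$-concave, on some half-line $(M,\infty)$). Definition of $\Sigma$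 (known well-definedness): $\mathrm{dom}\,\Sigma=\bigcup_{p\ge0}(\mathcal{D}^p\cap\mathcal{K}^p)$. If $g\in\mathcal{D}^p\cap\mathcal{K}^p$, then $\Sigma g\colon\mathbb{R}_+\to\mathbb{R}$ is the unique solution $f\in\mathcal{K}^p$ of $\Delta f=g$ on $\mathbb{R}_+$ with $f(1)=0$; it is given by the pointwise limit $$\Sigma g(x)=\lim_{n\to\infty}\Big(\sum_{k=1}^{n-1}g(k)-\sum_{k=0}^{n-1}g(x+k)+\sum_{j=1}^p\binom{x}{j}\Delta^{j-1}g(n)\Big),$$ and it does not depend on the choice of $p$. Iterates: $\Sigma^0=\mathrm{id}$, $\Sigma^{m+1}=\Sigma\circ\Sigma^m$; $g\in\mathrm{dom}\,\Sigma^{m+1}$ means $g\in\mathrm{dom}\,\Sigma^m$ and $\Sigma^mg\in\mathrm{dom}\,\Sigma$. It is known that $\mathcal{D}^p\cap\mathcal{K}^{p+m}\subset\mathrm{dom}\,\Sigma^{m+1}$. *)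

theory Defs
  imports Complex_Main "HOL-Computational_Algebra.Polynomial"
begin

text \<open>
  Functions on \<open>\<real>\<^sub>+ = (0,\<infinity>)\<close> are represented by functions of type \<^typ>\<open>real \<Rightarrow> real\<close>
  of which only the values on \<^term>\<open>{0::real<..}\<close> matter. Every notion below depends on its
  function argument only through those values.
\<close>

definition fwd_diff :: "(real \<Rightarrow> real) \<Rightarrow> real \<Rightarrow> real" where
  "fwd_diff f = (\<lambda>x. f (x + 1) - f x)"

text \<open>\<open>divdiff n f x\<close> is the divided difference \<open>f[x\<^sub>0, \<dots>, x\<^sub>n]\<close>.\<close>

primrec divdiff :: "nat \<Rightarrow> (real \<Rightarrow> real) \<Rightarrow> (nat \<Rightarrow> real) \<Rightarrow> real" where
  "divdiff 0 f x = f (x 0)"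
| "divdiff (Suc n) f x = (divdiff n f (\<lambda>i. x (Suc i)) - divdiff n f x) / (x (Suc n) - x 0)"

text \<open>
  The order \<open>p\<close> is an integer with \<open>p \<ge> -1\<close>, and the \<open>p + 2\<close> points are \<open>x\<^sub>0, \<dots>, x\<^bsub>p+1\<^esub>\<close>;
  for \<open>p = -1\<close> the condition says \<open>f \<ge> 0\<close> on \<open>I\<close>. Orders \<open>p < -1\<close> are not meaningful.
\<close>

definition p_convex_on :: "int \<Rightarrow> real set \<Rightarrow> (real \<Rightarrow> real) \<Rightarrow> bool" where
  "p_convex_on p I f \<longleftrightarrow>
     (\<forall>x. inj_on x {..nat (p + 1)} \<and> x ` {..nat (p + 1)} \<subseteq> I \<longrightarrow> divdiff (nat (p + 1)) f x \<ge> 0)"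

definition p_concave_on :: "int \<Rightarrow> real set \<Rightarrow> (real \<Rightarrow> real) \<Rightarrow> bool" where
  "p_concave_on p I f \<longleftrightarrow> p_convex_on p I (\<lambda>x. - f x)"

definition D_class :: "nat \<Rightarrow> (real \<Rightarrow> real) set" where
  "D_class p = {f. (\<lambda>n. (fwd_diff ^^ p) f (real n)) \<longlonglongrightarrow> 0}"

definition K_class :: "int \<Rightarrow> (real \<Rightarrow> real) set" where
  "K_class p = {f. \<exists>M\<ge>0. p_convex_on p {M<..} f \<or> p_concave_on p {M<..} f}"

text \<open>
  For \<open>g \<in> D_class p \<inter> K_class p\<close>, the unique solution \<open>f \<in> K_class p\<close> of \<open>\<Delta>f = g\<close> on
  \<open>\<real>\<^sub>+\<close> with \<open>f(1) = 0\<close>. This solution is the same for every admissible \<open>p\<close>, hence the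
  existential quantifier. The values on \<open>(-\<infinity>,0]\<close> are fixed to \<open>0\<close> only to make the
  solution unique as a function on \<^typ>\<open>real\<close>. Outside \<open>dom \<Sigma> = (\<Union>p. D_class p \<inter> K_class p)\<close>
  the value is unspecified.
\<close>

definition Sigma_op :: "(real \<Rightarrow> real) \<Rightarrow> real \<Rightarrow> real" where
  "Sigma_op g = (THE f. (\<exists>p::nat. g \<in> D_class p \<inter> K_class (int p) \<and> f \<in> K_class (int p)) \<and>
     (\<forall>x>0. fwd_diff f x = g x) \<and> f 1 = 0 \<and> (\<forall>x\<le>0. f x = 0))"

end

theory Submission
  imports Defs
begin

text \<open>
  Write \<open>\<Delta>\<close> for the forward difference and \<open>K\<^sup>p\<close>, \<open>D\<^sup>p\<close> for the two classes of functions. All the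
  analysis is in the single equation \<open>\<Delta>f = g\<close> with \<open>g \<in> D\<^sup>p \<inter> K\<^sup>p\<close>, and it comes from one
  estimate, \<open>newton_rem_bound\<close>. If \<open>f\<close> is \<open>p\<close>-convex on a half-line, its divided differences over
  \<open>p + 1\<close> nodes grow when the nodes move to the right. The remainder of the Newton interpolation of
  \<open>f\<close> at \<open>n, \<dots>, n + p\<close>, evaluated at \<open>n + x\<close>, is a multiple of the difference of two such divided
  differences. Trapping both between divided differences over consecutive nodes further to the left
  and further to the right bounds the remainder by a multiple of
  \<open>\<Delta>\<^sup>p f(n + k) - \<Delta>\<^sup>p f(n - k)\<close>, for a \<open>k\<close> that depends only on \<open>x\<close> and \<open>p\<close>.

  Uniqueness (\<open>difference_equation_unique\<close>): apply the estimate to two solutions in \<open>K\<^sup>p\<close>. Since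
  \<open>\<Delta>\<^sup>p g(n) \<rightarrow> 0\<close>, both remainders vanish in the limit. The difference of the solutions is
  1-periodic, so its remainder at every positive integer is its value at \<open>x\<close> minus its value at
  \<open>1\<close>. Existence (\<open>difference_equation_exists\<close>): apply the estimate to \<open>g\<close> itself. The increments
  of the approximants whose limit defines \<open>\<Sigma>g(x)\<close> are, up to sign, the remainders of \<open>g\<close>. These are
  absolutely summable because the bound is a sum of finitely many telescoping series. The limit
  has the opposite convexity to \<open>g\<close>, since every approximant is a sum of translates of \<open>- g\<close> plus a
  polynomial of degree at most \<open>p\<close>.

  The classes \<open>K\<^sup>p\<close> decrease in \<open>p\<close> and the classes \<open>D\<^sup>p\<close> increase. Hence \<open>\<Sigma>\<close> is independent of
  the admissible order, and it maps \<open>D\<^sup>q \<inter> K\<^sup>r\<close> into \<open>D\<^bsup>q+1\<^esup> \<inter> K\<^sup>r\<close> as long as \<open>q \<le> r\<close>; this is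
  what makes \<open>m + 1\<close> iterations possible when \<open>g \<in> D\<^sup>p \<inter> K\<^bsup>p+m\<^esup>\<close>. A solution of
  \<open>\<Delta>\<^bsup>m+1\<^esup> f = g\<close> is then recovered by summing \<open>m + 1\<close> times. Each summation replaces the polynomial
  part by one of its antidifferences and adds a constant. The degree stays at most \<open>m \<le> p + m\<close>, and
  polynomials of such degree do not affect membership in \<open>K\<^bsup>p+m\<^esup>\<close>. Finally \<open>\<Sigma>\<^bsup>m+1\<^esup> g\<close> vanishes at
  \<open>1, \<dots>, m + 1\<close>, and a polynomial of degree at most \<open>m\<close> with these zeros is \<open>0\<close>.
\<close>

section \<open>Divided differences as functions of the node set\<close>

text \<open>
  The Lagrange form of the divided difference. It is symmetric in the nodes by construction, so any
  node may be exchanged for another, while the recursive form only ever drops the first or the last.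
\<close>

definition divdiff_on :: "real set \<Rightarrow> (real \<Rightarrow> real) \<Rightarrow> real" where
  "divdiff_on A f = (\<Sum>a\<in>A. f a / (\<Prod>b\<in>A - {a}. a - b))"

lemma card_ge_1E:
  assumes "card A \<ge> 1"
  obtains a B where "A = insert a B" "a \<notin> B"
proof -
  obtain a where "a \<in> A" using assms by fastforce
  then show ?thesis using that[of a "A - {a}"] by blast
qed

text \<open>
  The recurrence of divided differences for an arbitrary pair of nodes. At a common node \<open>c\<close> it is
  the partial fraction \<open>(a - b) / ((c - a) (c - b)) = 1 / (c - a) - 1 / (c - b)\<close>.
\<close>

lemma divdiff_on_exchange:
  assumes "finite A" "a \<notin> A" "b \<notin> A" "a \<noteq> b"
  shows "(a - b) * divdiff_on (insert a (insert b A)) f = divdiff_on (insert a A) f - divdiff_on (insert b A) f"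
proof -
  have inner: "(a - b) * (f c / (\<Prod>e\<in>insert a (insert b A) - {c}. c - e))
      = f c / (\<Prod>e\<in>insert a A - {c}. c - e) - f c / (\<Prod>e\<in>insert b A - {c}. c - e)"
    if "c \<in> A" for c
  proof -
    have ne: "c \<noteq> a" "c \<noteq> b" using that assms by auto
    have s: "insert a (insert b A) - {c} = insert a (insert b (A - {c}))"
      "insert a A - {c} = insert a (A - {c})" "insert b A - {c} = insert b (A - {c})"
      using ne by auto
    define Q where "Q = (\<Prod>e\<in>A - {c}. c - e)"
    have pf: "(Y - X) * (v / (X * (Y * Q))) = v / (X * Q) - v / (Y * Q)"
      if "X \<noteq> 0" "Y \<noteq> 0" "Q \<noteq> 0" for X Y v :: real
      using that by (simp add: field_simps)
    have "Q \<noteq> 0" unfolding Q_def using assms(1) by simp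
    moreover have "(\<Prod>e\<in>insert a (insert b (A - {c})). c - e) = (c - a) * ((c - b) * Q)"
      "(\<Prod>e\<in>insert a (A - {c}). c - e) = (c - a) * Q"
      "(\<Prod>e\<in>insert b (A - {c}). c - e) = (c - b) * Q"
      using assms by (simp_all add: Q_def)
    ultimately show ?thesis
      unfolding s using ne pf[of "c - a" "c - b" "f c"] by simp
  qed
  have sa: "insert a (insert b A) - {a} = insert b A" "insert a (insert b A) - {b} = insert a A"
    "insert a A - {a} = A" "insert b A - {b} = A"
    using assms by auto
  define Qa where "Qa = (\<Prod>e\<in>A. a - e)"
  define Qb where "Qb = (\<Prod>e\<in>A. b - e)"
  have Q: "Qa \<noteq> 0" "Qb \<noteq> 0" unfolding Qa_def Qb_def using assms by auto
  have "(a - b) * divdiff_on (insert a (insert b A)) f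
      = (a - b) * (f a / ((a - b) * Qa)) + (a - b) * (f b / ((b - a) * Qb))
        + (\<Sum>c\<in>A. (a - b) * (f c / (\<Prod>e\<in>insert a (insert b A) - {c}. c - e)))"
    unfolding divdiff_on_def using assms
    by (simp add: sa Qa_def [symmetric] Qb_def [symmetric] distrib_left sum_distrib_left)
  also have "(a - b) * (f a / ((a - b) * Qa)) = f a / Qa"
    using assms(4) Q by (simp add: field_simps)
  also have "(a - b) * (f b / ((b - a) * Qb)) = - (f b / Qb)"
    using assms(4) Q by (simp add: field_simps)
  also have "(\<Sum>c\<in>A. (a - b) * (f c / (\<Prod>e\<in>insert a (insert b A) - {c}. c - e)))
      = (\<Sum>c\<in>A. f c / (\<Prod>e\<in>insert a A - {c}. c - e))
        - (\<Sum>c\<in>A. f c / (\<Prod>e\<in>insert b A - {c}. c - e))"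
    using inner by (simp add: sum_subtractf)
  finally show ?thesis
    unfolding divdiff_on_def using assms
    by (simp add: sa Qa_def [symmetric] Qb_def [symmetric])
qed

lemma divdiff_eq_divdiff_on:
  assumes "inj_on x {..n}"
  shows "divdiff n f x = divdiff_on (x ` {..n}) f"
  using assms
proof (induction n arbitrary: x)
  case 0
  then show ?case by (simp add: divdiff_on_def)
next
  case (Suc n)
  define A where "A = x ` {1..n}"
  have ne: "x (Suc n) \<noteq> x 0" using inj_onD[OF Suc.prems, of "Suc n" 0] by auto
  have nA: "x (Suc n) \<notin> A" "x 0 \<notin> A"
    unfolding A_def using inj_on_image_mem_iff[OF Suc.prems, of _ "{1..n}"] by auto
  have "{..Suc n} = insert (Suc n) (insert 0 {1..n})" "{..n} = insert 0 {1..n}"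
    "Suc ` {..n} = insert (Suc n) {1..n}"
    by (auto simp: image_Suc_atMost)
  then have img: "x ` {..Suc n} = insert (x (Suc n)) (insert (x 0) A)"
    "x ` {..n} = insert (x 0) A" "(\<lambda>i. x (Suc i)) ` {..n} = insert (x (Suc n)) A"
    unfolding A_def by (metis image_insert, metis image_insert, metis image_insert image_image)
  have inj: "inj_on x {..n}" "inj_on (\<lambda>i. x (Suc i)) {..n}"
    using Suc.prems by (auto simp: inj_on_def)
  have "(x (Suc n) - x 0) * divdiff_on (x ` {..Suc n}) f
      = divdiff_on ((\<lambda>i. x (Suc i)) ` {..n}) f - divdiff_on (x ` {..n}) f"
    unfolding img by (rule divdiff_on_exchange) (use ne nA in \<open>auto simp: A_def\<close>)
  then have "divdiff_on (x ` {..Suc n}) f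
      = (divdiff_on ((\<lambda>i. x (Suc i)) ` {..n}) f - divdiff_on (x ` {..n}) f) / (x (Suc n) - x 0)"
    using ne by (simp add: eq_divide_eq mult.commute)
  then show ?case
    by (simp only: divdiff.simps Suc.IH[OF inj(1)] Suc.IH[OF inj(2)])
qed

lemma p_convex_on_iff_divdiff_on:
  "p_convex_on (int p) I f \<longleftrightarrow>
     (\<forall>A. finite A \<and> card A = Suc (Suc p) \<and> A \<subseteq> I \<longrightarrow> 0 \<le> divdiff_on A f)"
proof -
  have n: "nat (int p + 1) = Suc p" by simp
  show ?thesis
  proof
    assume L: "p_convex_on (int p) I f"
    show "\<forall>A. finite A \<and> card A = Suc (Suc p) \<and> A \<subseteq> I \<longrightarrow> 0 \<le> divdiff_on A f"
    proof (intro allI impI)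
      fix A :: "real set" assume A: "finite A \<and> card A = Suc (Suc p) \<and> A \<subseteq> I"
      then obtain x where "bij_betw x {0..<Suc (Suc p)} A"
        using ex_bij_betw_nat_finite by metis
      moreover have "{0..<Suc (Suc p)} = {..Suc p}" by auto
      ultimately have x: "inj_on x {..Suc p}" "x ` {..Suc p} = A"
        by (simp_all add: bij_betw_def)
      then have "0 \<le> divdiff (Suc p) f x"
        using L A unfolding p_convex_on_def n by blast
      then show "0 \<le> divdiff_on A f" using divdiff_eq_divdiff_on[OF x(1)] x(2) by metis
    qed
  next
    assume R: "\<forall>A. finite A \<and> card A = Suc (Suc p) \<and> A \<subseteq> I \<longrightarrow> 0 \<le> divdiff_on A f"
    show "p_convex_on (int p) I f"
      unfolding p_convex_on_def n
    proof (intro allI impI)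
      fix x :: "nat \<Rightarrow> real"
      assume x: "inj_on x {..Suc p} \<and> x ` {..Suc p} \<subseteq> I"
      then have "card (x ` {..Suc p}) = Suc (Suc p)" by (simp add: card_image)
      then have "0 \<le> divdiff_on (x ` {..Suc p}) f" using R x by blast
      then show "0 \<le> divdiff (Suc p) f x" using divdiff_eq_divdiff_on x by metis
    qed
  qed
qed

lemma divdiff_on_cong: "(\<And>a. a \<in> A \<Longrightarrow> f a = h a) \<Longrightarrow> divdiff_on A f = divdiff_on A h"
  unfolding divdiff_on_def by (intro sum.cong) auto

lemma divdiff_on_add: "divdiff_on A (\<lambda>x. f x + h x) = divdiff_on A f + divdiff_on A h"
  unfolding divdiff_on_def by (simp add: add_divide_distrib sum.distrib)

lemma divdiff_on_cmult: "divdiff_on A (\<lambda>x. c * f x) = c * divdiff_on A f"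
  unfolding divdiff_on_def by (simp add: sum_distrib_left)

lemma divdiff_on_sum: "divdiff_on A (\<lambda>x. \<Sum>i\<in>S. f i x) = (\<Sum>i\<in>S. divdiff_on A (f i))"
  unfolding divdiff_on_def by (simp add: sum_divide_distrib) (rule sum.swap)

lemma divdiff_on_shift: "divdiff_on A (\<lambda>x. f (x + c)) = divdiff_on ((\<lambda>x. x + c) ` A) f"
proof -
  have "(\<Prod>b\<in>(\<lambda>x. x + c) ` A - {a + c}. a + c - b) = (\<Prod>b\<in>A - {a}. a - b)" for a
  proof -
    have "(\<lambda>x. x + c) ` A - {a + c} = (\<lambda>x. x + c) ` (A - {a})" by auto
    then show ?thesis by (simp add: prod.reindex)
  qed
  then show ?thesis unfolding divdiff_on_def by (simp add: sum.reindex)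
qed

text \<open>
  Constants are treated first because they end the induction on the degree in the next lemma.
\<close>

lemma divdiff_on_const:
  assumes "finite A" "card A \<ge> 2"
  shows "divdiff_on A (\<lambda>x. c) = 0"
  using assms(2,1)
proof (induction "card A" arbitrary: A rule: less_induct)
  case less
  obtain a B where B: "A = insert a B" "a \<notin> B"
    using card_ge_1E[of A] less.prems by (metis one_le_numeral order_trans)
  then have fB: "finite B" "card B \<ge> 1" using less.prems by auto
  obtain b C where C: "B = insert b C" "b \<notin> C"
    using card_ge_1E[of B] fB by blast
  have fC: "finite C" using C fB by simp
  have nn: "a \<notin> C" "a \<noteq> b" using B C by auto
  have "divdiff_on (insert a C) (\<lambda>x. c) - divdiff_on (insert b C) (\<lambda>x. c) = 0"
  proof (cases "C = {}")
    case True then show ?thesis by (simp add: divdiff_on_def)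
  next
    case False
    then have "card C \<ge> 1" using fC by (simp add: Suc_le_eq card_gt_0_iff)
    then have "divdiff_on (insert a C) (\<lambda>x. c) = 0" "divdiff_on (insert b C) (\<lambda>x. c) = 0"
      using B C fC nn by (auto intro!: less.hyps)
    then show ?thesis by simp
  qed
  then have "(a - b) * divdiff_on A (\<lambda>x. c) = 0"
    using divdiff_on_exchange[OF fC nn(1) C(2) nn(2)] B(1) C(1) by simp
  then show ?case using nn by simp
qed

text \<open>
  Choose a node \<open>b\<close> and write \<open>P = (x - b) Q + P(b)\<close>. The constant contributes nothing, and the
  factor \<open>x - b\<close> cancels against the node \<open>b\<close>, which leaves \<open>Q\<close> with one node fewer.
\<close>

lemma divdiff_on_poly_eq_0:
  assumes "finite A" "degree P + 2 \<le> card A"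
  shows "divdiff_on A (poly P) = 0"
  using assms
proof (induction "degree P" arbitrary: A P rule: less_induct)
  case less
  show ?case
  proof (cases "degree P = 0")
    case True
    then obtain c where "P = [:c:]" by (metis degree_eq_zeroE)
    then have "poly P = (\<lambda>x. c)" by auto
    then show ?thesis using divdiff_on_const less.prems by auto
  next
    case False
    obtain b B where B: "A = insert b B" "b \<notin> B"
      using card_ge_1E[of A] less.prems by (metis add_leD2 one_le_numeral order_trans)
    have fB: "finite B" "card A = Suc (card B)" using B less.prems by auto
    define Q where "Q = synthetic_div P b"
    have PQ: "poly P x = (x - b) * poly Q x + poly P b" for x
    proof -
      have "P = [:- b, 1:] * Q + [:poly P b:]"
        using synthetic_div_correct'[of b P] by (simp add: Q_def)
      then have "poly P x = poly ([:- b, 1:] * Q + [:poly P b:]) x" by simp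
      then show ?thesis by (simp add: algebra_simps)
    qed
    have dQ: "degree Q = degree P - 1" by (simp add: Q_def degree_synthetic_div)
    have "divdiff_on A (\<lambda>x. (x - b) * poly Q x) = divdiff_on B (poly Q)"
    proof -
      have "(c - b) * poly Q c / (\<Prod>e\<in>insert b B - {c}. c - e) = poly Q c / (\<Prod>e\<in>B - {c}. c - e)"
        if "c \<in> B" for c
      proof -
        have "c \<noteq> b" "insert b B - {c} = insert b (B - {c})" using that B by auto
        then show ?thesis using B fB by simp
      qed
      then show ?thesis unfolding divdiff_on_def B(1) using fB B by simp
    qed
    also have "\<dots> = 0" using less.hyps[of Q B] less.prems dQ False fB by simp
    finally have 0: "divdiff_on A (\<lambda>x. (x - b) * poly Q x) = 0" .
    have "divdiff_on A (poly P) = divdiff_on A (\<lambda>x. (x - b) * poly Q x + poly P b)"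
      by (intro divdiff_on_cong) (rule PQ)
    also have "\<dots> = divdiff_on A (\<lambda>x. (x - b) * poly Q x) + divdiff_on A (\<lambda>x. poly P b)" by (rule divdiff_on_add)
    also have "divdiff_on A (\<lambda>x. poly P b) = 0" by (rule divdiff_on_const) (use less.prems in auto)
    finally show ?thesis using 0 by simp
  qed
qed

text \<open>
  Moving one node to the right changes a divided difference over \<open>p + 1\<close> nodes by a positive multiple
  of one over \<open>p + 2\<close> nodes. The set \<open>C\<close> holds the nodes that stay fixed; it is there for the
  induction, in which each node that has already been moved is added to it.
\<close>

lemma divdiff_on_replace_mono:
  assumes conv: "p_convex_on (int p) {M<..} f"
    and "finite C" "finite A" "finite B" "card A = card B"
    and "\<forall>a\<in>A. \<forall>b\<in>B. a < b" "C \<inter> (A \<union> B) = {}"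
    and "card C + card A = Suc p" "C \<union> A \<union> B \<subseteq> {M<..}"
  shows "divdiff_on (C \<union> A) f \<le> divdiff_on (C \<union> B) f"
  using assms(3,2,4-)
proof (induction A arbitrary: B C rule: finite_induct)
  case empty
  then show ?case by simp
next
  case (insert a A)
  obtain b B' where B: "B = insert b B'" "b \<notin> B'"
    using card_ge_1E[of B] insert.prems(3) insert.hyps
    by (metis One_nat_def Suc_le_mono card_insert_disjoint zero_le)
  have ab: "a < b" using insert.prems B by simp
  have bA: "b \<notin> A" "b \<notin> C" "a \<notin> C" "a \<notin> A"
    using insert.prems(4,5) insert.hyps B by auto
  have disj: "C \<inter> A = {}" using insert.prems(5) by auto
  have cardCA: "card (C \<union> A) = p"
    using insert.prems insert.hyps disj by (simp add: card_Un_disjoint)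
  have "0 \<le> divdiff_on (insert b (insert a (C \<union> A))) f"
  proof -
    have "card (insert b (insert a (C \<union> A))) = Suc (Suc p)"
      using bA ab insert.prems(1) insert.hyps(1) cardCA by simp
    moreover have "insert b (insert a (C \<union> A)) \<subseteq> {M<..}" using insert.prems B by auto
    moreover have "finite (insert b (insert a (C \<union> A)))"
      using insert.prems(1) insert.hyps(1) by simp
    ultimately show ?thesis using conv p_convex_on_iff_divdiff_on by blast
  qed
  moreover have "(b - a) * divdiff_on (insert b (insert a (C \<union> A))) f
      = divdiff_on (insert b (C \<union> A)) f - divdiff_on (insert a (C \<union> A)) f"
    by (rule divdiff_on_exchange) (use bA ab insert.prems(1) insert.hyps(1) in auto)
  ultimately have "divdiff_on (insert a (C \<union> A)) f \<le> divdiff_on (insert b (C \<union> A)) f"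
    using ab by (metis diff_ge_0_iff_ge less_imp_le mult_nonneg_nonneg)
  also have "insert b (C \<union> A) = insert b C \<union> A" by simp
  also have "divdiff_on (insert b C \<union> A) f \<le> divdiff_on (insert b C \<union> B') f"
  proof (rule insert.IH)
    show "finite (insert b C)" "finite B'" using insert.prems B by auto
    show "card A = card B'" using insert.prems insert.hyps B by simp
    show "\<forall>a\<in>A. \<forall>b\<in>B'. a < b" using insert.prems(4) B by blast
    show "insert b C \<inter> (A \<union> B') = {}" using insert.prems(5) bA B by blast
    show "card (insert b C) + card A = Suc p"
      using insert.prems(1,6) insert.hyps bA by simp
    show "insert b C \<union> A \<union> B' \<subseteq> {M<..}" using insert.prems(7) B by blast
  qed
  finally show ?case using B by simp
qed

lemma divdiff_on_mono:
  assumes "p_convex_on (int p) {M<..} f"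
    and "finite A" "finite B" "card A = Suc p" "card B = Suc p"
    and "\<forall>a\<in>A. \<forall>b\<in>B. a < b" "A \<subseteq> {M<..}" "B \<subseteq> {M<..}"
  shows "divdiff_on A f \<le> divdiff_on B f"
  using divdiff_on_replace_mono[OF assms(1), of "{}" A B] assms by simp

section \<open>Eventual convexity and forward differences\<close>

text \<open>
  The sign \<open>s\<close> lets eventually convex and eventually concave functions be treated by one argument.
\<close>

lemma K_class_iff:
  "f \<in> K_class (int p) \<longleftrightarrow>
     (\<exists>M\<ge>0. \<exists>s\<in>{1, -1}. p_convex_on (int p) {M<..} (\<lambda>x. s * f x))"
  unfolding K_class_def p_concave_on_def by auto

text \<open>
  Only half-lines \<open>(M,\<infinity>)\<close> with \<open>M \<ge> 0\<close> enter the definition, so values at nonpositive arguments are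
  irrelevant.
\<close>

lemma K_class_cong:
  assumes "\<forall>x>0. f x = h x"
  shows "f \<in> K_class (int p) \<longleftrightarrow> h \<in> K_class (int p)"
proof -
  have "p_convex_on (int p) {M<..} (\<lambda>x. s * f x) \<longleftrightarrow> p_convex_on (int p) {M<..} (\<lambda>x. s * h x)"
    if "M \<ge> 0" for M s
  proof -
    have "divdiff_on A (\<lambda>x. s * f x) = divdiff_on A (\<lambda>x. s * h x)" if "A \<subseteq> {M<..}" for A
      using that \<open>M \<ge> 0\<close> assms by (intro divdiff_on_cong) force
    then show ?thesis unfolding p_convex_on_iff_divdiff_on by (metis (no_types, lifting))
  qed
  then show ?thesis unfolding K_class_iff by blast
qed

lemma K_class_add_poly:
  assumes "f \<in> K_class (int p)" "degree P \<le> p"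
  shows "(\<lambda>x. f x + poly P x) \<in> K_class (int p)"
proof -
  obtain M s where M: "M \<ge> 0" "s \<in> {1, -1}" "p_convex_on (int p) {M<..} (\<lambda>x. s * f x)"
    using assms(1) unfolding K_class_iff by blast
  have "divdiff_on A (\<lambda>x. s * (f x + poly P x)) = divdiff_on A (\<lambda>x. s * f x)"
    if "finite A" "card A = Suc (Suc p)" for A
    using divdiff_on_poly_eq_0[of A P] that assms by (simp add: divdiff_on_cmult divdiff_on_add)
  then have "p_convex_on (int p) {M<..} (\<lambda>x. s * (f x + poly P x))"
    using M(3) unfolding p_convex_on_iff_divdiff_on by simp
  then show ?thesis using M K_class_iff by blast
qed

text \<open>
  For a \<open>(p + 1)\<close>-convex function the divided differences over \<open>p + 2\<close> nodes are monotone in the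
  nodes. Hence either one of them is positive, and then so are all those over nodes further to
  the right, or none is.
\<close>

lemma K_class_Suc_subset: "K_class (int (Suc p)) \<subseteq> K_class (int p)"
proof
  fix f assume "f \<in> K_class (int (Suc p))"
  then obtain M s where M: "M \<ge> 0" "s \<in> {1, -1}" "p_convex_on (int (Suc p)) {M<..} (\<lambda>x. s * f x)"
    using K_class_iff by blast
  define h where "h = (\<lambda>x. s * f x)"
  show "f \<in> K_class (int p)"
  proof (cases "\<exists>A. finite A \<and> card A = Suc (Suc p) \<and> A \<subseteq> {M<..} \<and> 0 < divdiff_on A h")
    case True
    then obtain A where A: "finite A" "card A = Suc (Suc p)" "A \<subseteq> {M<..}" "0 < divdiff_on A h" by blast
    (* every set of nodes beyond N lies to the right of A *)
    define N where "N = max M (Max A)"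
    have "0 \<le> divdiff_on B h" if B: "finite B" "card B = Suc (Suc p)" "B \<subseteq> {N<..}" for B
    proof -
      have "\<forall>a\<in>A. \<forall>b\<in>B. a < b"
      proof (intro ballI)
        fix a b assume "a \<in> A" "b \<in> B"
        then have "a \<le> Max A" "Max A < b" using A B by (auto simp: N_def)
        then show "a < b" by simp
      qed
      moreover have "B \<subseteq> {M<..}" using B by (auto simp: N_def)
      ultimately have "divdiff_on A h \<le> divdiff_on B h"
        using divdiff_on_mono[OF M(3)[folded h_def]] A B by blast
      then show ?thesis using A by simp
    qed
    then have "p_convex_on (int p) {N<..} h" unfolding p_convex_on_iff_divdiff_on by blast
    moreover have "N \<ge> 0" using M by (simp add: N_def)
    ultimately show ?thesis unfolding K_class_iff h_def using M(2) by blast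
  next
    case False
    have "divdiff_on A (\<lambda>x. - s * f x) = - divdiff_on A h" for A
      unfolding h_def by (simp add: divdiff_on_cmult [of A "-1", simplified] divdiff_on_cmult)
    then have "p_convex_on (int p) {M<..} (\<lambda>x. - s * f x)"
      using False unfolding p_convex_on_iff_divdiff_on by (metis (no_types, lifting) linorder_not_less neg_0_le_iff_le)
    moreover have "- s \<in> {1, -1}" using M(2) by auto
    ultimately show ?thesis unfolding K_class_iff using M(1) by blast
  qed
qed

lemma K_class_antimono: "p \<le> q \<Longrightarrow> K_class (int q) \<subseteq> K_class (int p)"
  using lift_Suc_antimono_le[of "\<lambda>n. K_class (int n)"] K_class_Suc_subset by blast

lemma fwd_diff_pow_Suc: "(fwd_diff ^^ Suc j) f y = (fwd_diff ^^ j) f (y + 1) - (fwd_diff ^^ j) f y"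
  by (simp add: fwd_diff_def)

lemma fwd_diff_pow_Suc': "(fwd_diff ^^ Suc j) f = (fwd_diff ^^ j) (fwd_diff f)"
  by (simp add: funpow_swap1)

lemma fwd_diff_pow_cong:
  assumes "\<forall>x>0. f x = h x"
  shows "\<forall>x>0. (fwd_diff ^^ j) f x = (fwd_diff ^^ j) h x"
  by (induction j) (use assms in \<open>auto simp: fwd_diff_def\<close>)

lemma fwd_diff_pow_cmult: "(fwd_diff ^^ j) (\<lambda>x. c * f x) y = c * (fwd_diff ^^ j) f y"
  by (induction j arbitrary: y) (auto simp: fwd_diff_def algebra_simps)

lemma fwd_diff_pow_plus:
  "(fwd_diff ^^ j) (\<lambda>x. f x + h x) y = (fwd_diff ^^ j) f y + (fwd_diff ^^ j) h y"
  by (induction j arbitrary: y) (auto simp: fwd_diff_def algebra_simps)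

lemma fwd_diff_pow_poly: "\<exists>Q. degree Q \<le> degree P \<and> (fwd_diff ^^ j) (poly P) = poly Q"
proof (induction j)
  case 0
  then show ?case by auto
next
  case (Suc j)
  then obtain Q where Q: "degree Q \<le> degree P" "(fwd_diff ^^ j) (poly P) = poly Q" by blast
  define R where "R = pcompose Q [:1, 1:] - Q"
  have "degree R \<le> degree P"
    unfolding R_def using Q(1) by (intro degree_diff_le) (auto simp: degree_pcompose)
  moreover have "(fwd_diff ^^ Suc j) (poly P) = poly R"
    using Q(2) by (auto simp: fwd_diff_def R_def poly_pcompose add.commute)
  ultimately show ?case by blast
qed

lemma D_class_mono:
  assumes "p \<le> q" shows "D_class p \<subseteq> D_class q"
proof -
  have "f \<in> D_class (Suc n)" if "f \<in> D_class n" for f n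
  proof -
    define u where "u = (\<lambda>i. (fwd_diff ^^ n) f (real i))"
    have "u \<longlonglongrightarrow> 0" using that by (simp add: D_class_def u_def)
    then have "(\<lambda>i. u (Suc i) - u i) \<longlonglongrightarrow> 0 - 0"
      by (intro tendsto_diff LIMSEQ_Suc)
    then show ?thesis by (simp add: D_class_def fwd_diff_def u_def add.commute)
  qed
  then show ?thesis using lift_Suc_mono_le[of D_class] assms by blast
qed

section \<open>Newton interpolation at equidistant nodes\<close>

text \<open>
  The error at \<open>y + x\<close> of the polynomial that interpolates \<open>f\<close> at \<open>y, y + 1, \<dots>, y + p - 1\<close>.
\<close>

definition newton_rem :: "nat \<Rightarrow> (real \<Rightarrow> real) \<Rightarrow> real \<Rightarrow> real \<Rightarrow> real" where
  "newton_rem p f y x = f (y + x) - (\<Sum>j<p. (x gchoose j) * (fwd_diff ^^ j) f y)"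

definition nodes :: "nat \<Rightarrow> real \<Rightarrow> real set" where
  "nodes p y = (\<lambda>i. y + real i) ` {..<p}"

lemma nodes_Suc: "nodes (Suc p) y = insert (y + real p) (nodes p y)"
  by (simp add: nodes_def lessThan_Suc)

lemma finite_nodes [simp]: "finite (nodes p y)"
  by (simp add: nodes_def)

lemma card_nodes [simp]: "card (nodes p y) = p"
  unfolding nodes_def by (subst card_image) (auto simp: inj_on_def)

lemma nodes_bounds: "a \<in> nodes p y \<Longrightarrow> y \<le> a \<and> a \<le> y + real p - 1"
  unfolding nodes_def by (force simp: Suc_le_eq [symmetric] simp flip: of_nat_Suc)

lemma mem_nodes_iff: "y + x \<in> nodes p y \<longleftrightarrow> x \<in> real ` {..<p}"
  by (auto simp: nodes_def)

lemma divdiff_on_nodes: "divdiff_on (nodes (Suc p) y) f = (fwd_diff ^^ p) f y / fact p"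
proof -
  have "divdiff p f (\<lambda>i. y + real i) = (fwd_diff ^^ p) f y / fact p" for y
  proof (induction p arbitrary: y)
    case (Suc p)
    have "(\<lambda>i. y + real (Suc i)) = (\<lambda>i. (y + 1) + real i)" by auto
    then show ?case using Suc.IH[of y] Suc.IH[of "y + 1"]
      unfolding fwd_diff_pow_Suc by (simp add: diff_divide_distrib [symmetric] mult.commute)
  qed simp
  moreover have "divdiff p f (\<lambda>i. y + real i) = divdiff_on ((\<lambda>i. y + real i) ` {..p}) f"
    by (rule divdiff_eq_divdiff_on) (auto simp: inj_on_def)
  ultimately show ?thesis by (simp add: nodes_def lessThan_Suc_atMost)
qed

lemma prod_eq_gbinomial: "(\<Prod>i<p. x - real i) = fact p * (x gchoose p)"
  by (simp add: gbinomial_prod_rev atLeast0LessThan)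

lemma newton_rem_Suc: "newton_rem (Suc p) f y x = newton_rem p f y x - (x gchoose p) * (fwd_diff ^^ p) f y"
  by (simp add: newton_rem_def)

lemma newton_rem_eq_divdiff_on:
  assumes "x \<notin> real ` {..<p}"
  shows "newton_rem p f y x = (\<Prod>i<p. x - real i) * divdiff_on (insert (y + x) (nodes p y)) f"
  using assms
proof (induction p)
  case 0
  then show ?case by (simp add: newton_rem_def nodes_def divdiff_on_def)
next
  case (Suc p)
  define a where "a = y + x"
  define b where "b = y + real p"
  have nm: "x \<notin> real ` {..<p}" and ne: "a \<noteq> b"
    using Suc.prems by (auto simp: lessThan_Suc a_def b_def)
  have out: "a \<notin> nodes p y" "b \<notin> nodes p y"
    unfolding a_def b_def mem_nodes_iff using nm by auto
  have "newton_rem (Suc p) f y x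
      = (\<Prod>i<p. x - real i) * (divdiff_on (insert a (nodes p y)) f - divdiff_on (insert b (nodes p y)) f)"
    using Suc.IH[OF nm] divdiff_on_nodes[of p y f]
    by (simp add: newton_rem_Suc nodes_Suc prod_eq_gbinomial a_def b_def algebra_simps)
  also have "divdiff_on (insert a (nodes p y)) f - divdiff_on (insert b (nodes p y)) f
      = (x - real p) * divdiff_on (insert a (insert b (nodes p y))) f"
    using divdiff_on_exchange[OF finite_nodes out ne, of f] by (simp add: a_def b_def)
  finally show ?case by (simp add: nodes_Suc a_def b_def)
qed

text \<open>
  This form of the remainder involves only divided differences over \<open>p + 1\<close> nodes, which are the
  monotone ones for a \<open>p\<close>-convex \<open>f\<close>. It holds for \<open>x = p\<close> too, where both sides vanish.
\<close>

lemma newton_rem_Suc_eq_divdiff_on: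
  assumes "x \<notin> real ` {..<p}"
  shows "newton_rem (Suc p) f y x
      = (\<Prod>i<p. x - real i) * (divdiff_on (insert (y + x) (nodes p y)) f - divdiff_on (nodes (Suc p) y) f)"
  using newton_rem_eq_divdiff_on[OF assms, of f y]
  by (simp add: newton_rem_Suc divdiff_on_nodes prod_eq_gbinomial algebra_simps)

text \<open>
  The case left out by the divided difference formulas: at a node the interpolation is exact.
\<close>

lemma newton_rem_at_node:
  assumes "i < p"
  shows "newton_rem p f y (real i) = 0"
  using assms
proof (induction p)
  case (Suc p)
  show ?case
  proof (cases "i = p")
    case True
    have "real p \<notin> real ` {..<p}" by auto
    from newton_rem_Suc_eq_divdiff_on[OF this] show ?thesis
      using True by (simp add: nodes_Suc)
  next
    case False
    then have "i < p" using Suc.prems by simp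
    then show ?thesis using Suc.IH
      by (simp add: newton_rem_Suc binomial_gbinomial [symmetric])
  qed
qed simp

text \<open>
  The two divided differences in the remainder at \<open>z = y + k\<close> have all their nodes in \<open>[z, z + k)\<close>,
  strictly between the nodes \<open>y, \<dots>, y + p\<close> and the nodes \<open>y + 2k, \<dots>, y + 2k + p\<close>. By monotonicity
  they differ by at most the difference of the two outer divided differences.
\<close>

lemma newton_rem_bound:
  assumes conv: "p_convex_on (int p) {M<..} f" and y: "M < y" and "0 < x" "x < real k" "p < k"
  shows "\<bar>newton_rem (Suc p) f (y + real k) x\<bar>
      \<le> \<bar>x gchoose p\<bar> * ((fwd_diff ^^ p) f (y + real (2 * k)) - (fwd_diff ^^ p) f y)"
proof -
  define z where "z = y + real k"
  define lo where "lo = divdiff_on (nodes (Suc p) y) f"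
  define hi where "hi = divdiff_on (nodes (Suc p) (y + real (2 * k))) f"
  have pk: "real p + 1 \<le> real k" using \<open>p < k\<close> by linarith
  have sandwich: "lo \<le> divdiff_on C f \<and> divdiff_on C f \<le> hi"
    if C: "finite C" "card C = Suc p" "\<forall>a\<in>C. z \<le> a \<and> a < z + real k" for C
  proof
    have "\<forall>a\<in>nodes (Suc p) y. \<forall>b\<in>C. a < b"
      using nodes_bounds[of _ "Suc p" y] C(3) pk by (force simp: z_def)
    moreover have "nodes (Suc p) y \<subseteq> {M<..}" "C \<subseteq> {M<..}"
      using C(3) y nodes_bounds[of _ "Suc p" y] by (force simp: z_def)+
    ultimately show "lo \<le> divdiff_on C f"
      unfolding lo_def using C by (intro divdiff_on_mono[OF conv]) auto
    have "\<forall>a\<in>C. \<forall>b\<in>nodes (Suc p) (y + real (2 * k)). a < b"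
      using nodes_bounds[of _ "Suc p" "y + real (2 * k)"] C(3) by (force simp: z_def)
    moreover have "nodes (Suc p) (y + real (2 * k)) \<subseteq> {M<..}" "C \<subseteq> {M<..}"
      using C(3) y nodes_bounds[of _ "Suc p" "y + real (2 * k)"] by (force simp: z_def)+
    ultimately show "divdiff_on C f \<le> hi"
      unfolding hi_def using C by (intro divdiff_on_mono[OF conv]) auto
  qed
  have B: "lo \<le> divdiff_on (nodes (Suc p) z) f \<and> divdiff_on (nodes (Suc p) z) f \<le> hi"
    using nodes_bounds[of _ "Suc p" z] pk by (intro sandwich) force+
  have "\<bar>newton_rem (Suc p) f z x\<bar> \<le> \<bar>\<Prod>i<p. x - real i\<bar> * (hi - lo)"
  proof (cases "x \<in> real ` {..<p}")
    case True
    then have "newton_rem (Suc p) f z x = 0" using newton_rem_at_node[of _ "Suc p"] by auto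
    then show ?thesis using B by simp
  next
    case False
    define A where "A = insert (z + x) (nodes p z)"
    have "\<forall>a\<in>A. z \<le> a \<and> a < z + real k"
      using assms pk nodes_bounds[of _ p z] by (force simp: A_def)
    moreover have "finite A" "card A = Suc p"
      using False by (auto simp: A_def mem_nodes_iff)
    ultimately have "lo \<le> divdiff_on A f \<and> divdiff_on A f \<le> hi" by (intro sandwich) auto
    then have "\<bar>divdiff_on A f - divdiff_on (nodes (Suc p) z) f\<bar> \<le> hi - lo"
      using B by linarith
    then show ?thesis
      unfolding newton_rem_Suc_eq_divdiff_on[OF False] A_def [symmetric] abs_mult
      by (rule mult_left_mono) simp
  qed
  also have "\<dots> = \<bar>x gchoose p\<bar> * ((fwd_diff ^^ p) f (y + real (2 * k)) - (fwd_diff ^^ p) f y)"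
    unfolding hi_def lo_def divdiff_on_nodes prod_eq_gbinomial
    by (simp add: abs_mult flip: diff_divide_distrib)
  finally show ?thesis by (simp add: z_def)
qed

text \<open>
  The sign \<open>s\<close> is kept because an absolute value of the difference would not telescope when the bound
  is summed over \<open>n\<close>.
\<close>

lemma newton_rem_bound_K_class:
  assumes "f \<in> K_class (int p)" "0 < x"
  obtains k s where "\<forall>\<^sub>F n in sequentially. \<bar>newton_rem (Suc p) f (real (n + k)) x\<bar>
      \<le> \<bar>x gchoose p\<bar> * (s * ((fwd_diff ^^ p) f (real (n + 2 * k)) - (fwd_diff ^^ p) f (real n)))"
proof -
  obtain M s where M: "M \<ge> 0" "s \<in> {1, -1}" "p_convex_on (int p) {M<..} (\<lambda>x. s * f x)"
    using assms(1) unfolding K_class_iff by blast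
  (* k must exceed x and p for the outer nodes to clear the inner ones *)
  obtain k where k: "max x (real p) < real k" using reals_Archimedean2 by blast
  have s: "newton_rem (Suc p) (\<lambda>x. s * f x) y x = s * newton_rem (Suc p) f y x" for y
    unfolding newton_rem_def fwd_diff_pow_cmult
    by (simp add: algebra_simps sum_distrib_left del: funpow.simps sum.lessThan_Suc)
  have s1: "\<bar>s\<bar> = 1" using M by auto
  obtain N :: nat where N: "M < real N" using reals_Archimedean2 by blast
  have "\<bar>newton_rem (Suc p) f (real (n + k)) x\<bar>
      \<le> \<bar>x gchoose p\<bar> * (s * ((fwd_diff ^^ p) f (real (n + 2 * k)) - (fwd_diff ^^ p) f (real n)))"
    if "n \<ge> N" for n
  proof -
    have "M < real n" using N that by linarith
    from newton_rem_bound[OF M(3) this \<open>0 < x\<close>, of k] k s1 show ?thesis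
      unfolding s fwd_diff_pow_cmult right_diff_distrib [symmetric] abs_mult by simp
  qed
  then show ?thesis using that eventually_sequentially by blast
qed

lemma newton_rem_tendsto_0:
  assumes "f \<in> K_class (int p)" "0 < x"
    and "(\<lambda>n. (fwd_diff ^^ Suc p) f (real n)) \<longlonglongrightarrow> 0"
  shows "(\<lambda>n. newton_rem (Suc p) f (real n) x) \<longlonglongrightarrow> 0"
proof -
  define u where "u = (\<lambda>n. (fwd_diff ^^ p) f (real n))"
  obtain k s where k: "\<forall>\<^sub>F n in sequentially. \<bar>newton_rem (Suc p) f (real (n + k)) x\<bar>
      \<le> \<bar>x gchoose p\<bar> * (s * (u (n + 2 * k) - u n))"
    using newton_rem_bound_K_class[OF assms(1,2)] unfolding u_def by blast
  have inc: "(\<lambda>n. u (Suc n) - u n) \<longlonglongrightarrow> 0"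
    using assms(3) by (simp add: u_def fwd_diff_def add.commute)
  have "(\<lambda>n. u (n + i) - u n) \<longlonglongrightarrow> 0" for i
  proof (induction i)
    case (Suc i)
    have "(\<lambda>n. (u (n + i) - u n) + (u (Suc (n + i)) - u (n + i))) \<longlonglongrightarrow> 0 + 0"
      by (intro tendsto_add Suc.IH LIMSEQ_ignore_initial_segment[OF inc])
    then show ?case by simp
  qed simp
  then have "(\<lambda>n. \<bar>x gchoose p\<bar> * (s * (u (n + 2 * k) - u n))) \<longlonglongrightarrow> 0"
    by (intro tendsto_mult_right_zero)
  then have "(\<lambda>n. newton_rem (Suc p) f (real (n + k)) x) \<longlonglongrightarrow> 0"
    by (intro tendsto_rabs_zero_cancel[OF tendsto_sandwich[OF _ k tendsto_const]]) simp_all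
  then show ?thesis by (rule LIMSEQ_offset)
qed

lemma newton_rem_summable:
  assumes "f \<in> K_class (int p)" "0 < x" "f \<in> D_class p"
  shows "summable (\<lambda>n. newton_rem (Suc p) f (real n) x)"
proof -
  define u where "u = (\<lambda>n. (fwd_diff ^^ p) f (real n))"
  obtain k s where k: "\<forall>\<^sub>F n in sequentially. \<bar>newton_rem (Suc p) f (real (n + k)) x\<bar>
      \<le> \<bar>x gchoose p\<bar> * (s * (u (n + 2 * k) - u n))"
    using newton_rem_bound_K_class[OF assms(1,2)] unfolding u_def by blast
  have u0: "u \<longlonglongrightarrow> 0" using assms(3) by (simp add: D_class_def u_def)
  have "summable (\<lambda>n. u (n + i) - u n)" for i
  proof (induction i)
    case (Suc i)
    have "summable (\<lambda>n. u (Suc n + i) - u (n + i))"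
      using telescope_summable[OF LIMSEQ_ignore_initial_segment[OF u0]] .
    from summable_add[OF Suc.IH this] show ?case by simp
  qed simp
  then have "summable (\<lambda>n. \<bar>x gchoose p\<bar> * (s * (u (n + 2 * k) - u n)))"
    by (intro summable_mult)
  then have "summable (\<lambda>n. newton_rem (Suc p) f (real (n + k)) x)"
    by (rule summable_comparison_test_ev[rotated]) (use k in simp)
  then show ?thesis by (rule iffD1[OF summable_iff_shift])
qed

section \<open>The indefinite sum of a function\<close>

text \<open>
  The difference \<open>d\<close> of two solutions is 1-periodic and hence constant on the positive integers. So
  \<open>d(x) - d(1)\<close> is the difference of the two Newton remainders at every positive integer \<open>n\<close>, and
  both of these tend to \<open>0\<close>.
\<close>

lemma difference_equation_unique:
  assumes "g \<in> D_class p" "f1 \<in> K_class (int p)" "f2 \<in> K_class (int p)"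
    and eq: "\<forall>x>0. fwd_diff f1 x = g x" "\<forall>x>0. fwd_diff f2 x = g x" and "0 < x"
  shows "f1 x - f2 x = f1 1 - f2 1"
proof -
  define d where "d = (\<lambda>x. f1 x - f2 x)"
  have per: "d (y + real n) = d y" if "y > 0" for y n
  proof (induction n)
    case (Suc n)
    have "y + real n > 0" using that by simp
    then have "d (y + real n + 1) = d (y + real n)"
      using eq by (force simp: d_def fwd_diff_def)
    then show ?case using Suc by (simp add: algebra_simps)
  qed simp
  have diffs: "(fwd_diff ^^ Suc j) f y = (fwd_diff ^^ j) g y"
    if "\<forall>x>0. fwd_diff f x = g x" "y > 0" for f j y
    unfolding fwd_diff_pow_Suc' using fwd_diff_pow_cong[OF that(1)] that(2) by blast
  have lim: "(\<lambda>n. newton_rem (Suc p) f (real n) x) \<longlonglongrightarrow> 0"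
    if "f \<in> K_class (int p)" "\<forall>x>0. fwd_diff f x = g x" for f
  proof (rule newton_rem_tendsto_0[OF that(1) \<open>0 < x\<close>])
    have "(\<lambda>n. (fwd_diff ^^ p) g (real n)) \<longlonglongrightarrow> 0" using assms(1) by (simp add: D_class_def)
    then show "(\<lambda>n. (fwd_diff ^^ Suc p) f (real n)) \<longlonglongrightarrow> 0"
      by (rule Lim_transform_eventually)
         (use diffs[OF that(2)] in \<open>auto intro!: eventually_sequentiallyI[of 1] simp del: funpow.simps\<close>)
  qed
  have "(\<lambda>n. newton_rem (Suc p) f1 (real n) x - newton_rem (Suc p) f2 (real n) x) \<longlonglongrightarrow> 0 - 0"
    by (intro tendsto_diff lim assms)
  then have "(\<lambda>n::nat. d x - d 1) \<longlonglongrightarrow> 0 - 0"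
  proof (rule Lim_transform_eventually, intro eventually_sequentiallyI[of 1])
    fix n :: nat assume "n \<ge> 1"
    have "(fwd_diff ^^ Suc j) f1 (real n) = (fwd_diff ^^ Suc j) f2 (real n)" for j
      using diffs eq \<open>n \<ge> 1\<close> by simp
    then have "newton_rem (Suc p) f1 (real n) x - newton_rem (Suc p) f2 (real n) x
        = d (x + real n) - d (real n)"
      unfolding newton_rem_def sum.lessThan_Suc_shift by (simp add: d_def add.commute)
    moreover have "d (real n) = d 1"
      using per[of 1 "n - 1"] \<open>n \<ge> 1\<close> by simp
    ultimately show "newton_rem (Suc p) f1 (real n) x - newton_rem (Suc p) f2 (real n) x = d x - d 1"
      using per[OF \<open>0 < x\<close>] by simp
  qed
  then have "d x - d 1 = 0" by (simp add: LIMSEQ_const_iff)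
  then show ?thesis by (simp add: d_def)
qed

text \<open>
  The approximants in the limit formula for \<open>\<Sigma>g\<close>. The index \<open>j\<close> is shifted by one against the usual
  notation, so that the last sum runs over \<open>j < p\<close>.
\<close>

definition sum_approx :: "nat \<Rightarrow> (real \<Rightarrow> real) \<Rightarrow> nat \<Rightarrow> real \<Rightarrow> real" where
  "sum_approx p g n x = (\<Sum>k=1..<n. g (real k)) - (\<Sum>k<n. g (x + real k))
     + (\<Sum>j<p. (x gchoose Suc j) * (fwd_diff ^^ j) g (real n))"

lemma sum_approx_Suc:
  assumes "n \<ge> 1"
  shows "sum_approx p g (Suc n) x - sum_approx p g n x = - newton_rem (Suc p) g (real n) x"
proof -
  have "(fwd_diff ^^ j) g (real (Suc n)) = (fwd_diff ^^ j) g (real n) + (fwd_diff ^^ Suc j) g (real n)" for j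
    by (simp add: fwd_diff_def add.commute)
  then show ?thesis
    using assms
    unfolding sum_approx_def newton_rem_def sum.lessThan_Suc_shift[of _ p]
    by (simp add: distrib_left sum.distrib add.commute del: funpow.simps)
qed

lemma gbinomial_sum_fwd_diff:
  fixes x :: real
  shows "(\<Sum>j<p. (x + 1 gchoose Suc j) * c j) - (\<Sum>j<p. (x gchoose Suc j) * c j)
      = (\<Sum>j<p. (x gchoose j) * c j)"
  by (simp add: gbinomial_Suc_Suc distrib_right sum.distrib)

text \<open>
  The approximants solve \<open>\<Delta>f = g\<close> up to an interpolation error that tends to \<open>0\<close> as \<open>n \<rightarrow> \<infinity>\<close>.
\<close>

lemma sum_approx_step:
  "sum_approx p g n (x + 1) - sum_approx p g n x = g x - newton_rem p g (real n) x"
proof -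
  have "(\<Sum>k<n. g (x + real (Suc k)) - g (x + real k)) = g (x + real n) - g x"
    by (subst sum_lessThan_telescope) simp
  then show ?thesis
    unfolding sum_approx_def newton_rem_def
    using gbinomial_sum_fwd_diff[of x "\<lambda>j. (fwd_diff ^^ j) g (real n)" p]
    by (simp add: sum_subtractf algebra_simps)
qed

lemma sum_approx_1:
  assumes "n \<ge> 1"
  shows "sum_approx p g n 1 = (if p = 0 then - g (real n) else 0)"
proof -
  have z: "(1::real) gchoose Suc (Suc j) = 0" for j
    using binomial_gbinomial[of 1 "Suc (Suc j)", where 'a = real] by simp
  have "(\<Sum>k<n. g (1 + real k)) = (\<Sum>k=1..n. g (real k))"
    by (rule sum.reindex_bij_witness[of _ "\<lambda>k. k - 1" Suc]) auto
  also have "\<dots> = (\<Sum>k=1..<n. g (real k)) + g (real n)"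
    using assms by (simp add: sum.last_plus atLeastLessThanSuc_atLeastAtMost [symmetric])
  finally have 1: "(\<Sum>k<n. g (1 + real k)) = (\<Sum>k=1..<n. g (real k)) + g (real n)" .
  show ?thesis
    unfolding sum_approx_def 1
    by (cases p) (simp_all add: sum.lessThan_Suc_shift z del: sum.lessThan_Suc funpow.simps)
qed

lemma gbinomial_poly: "\<exists>P :: real poly. degree P \<le> j \<and> (\<forall>x. poly P x = x gchoose j)"
proof (induction j)
  case 0
  then show ?case by (intro exI[of _ 1]) simp
next
  case (Suc j)
  then obtain P :: "real poly" where P: "degree P \<le> j" "\<forall>x. poly P x = x gchoose j" by blast
  define Q where "Q = smult (1 / real (Suc j)) (P * [:- real j, 1:])"
  have "degree Q \<le> Suc j"
    unfolding Q_def using degree_mult_le[of P "[:- real j, 1:]"] P(1) by simp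
  moreover have "poly Q x = x gchoose Suc j" for x
    using P(2) gbinomial_absorb_comp[of x j] gbinomial_mult_1[of x j]
    by (simp add: Q_def field_simps)
  ultimately show ?case by blast
qed

lemma gbinomial_sum_poly:
  "\<exists>P :: real poly. degree P \<le> p \<and> (\<forall>x. poly P x = (\<Sum>j<p. (x gchoose Suc j) * c j))"
proof (induction p)
  case (Suc p)
  then obtain P where P: "degree P \<le> p" "\<forall>x. poly P x = (\<Sum>j<p. (x gchoose Suc j) * c j)" by blast
  obtain R :: "real poly" where R: "degree R \<le> Suc p" "\<forall>x. poly R x = x gchoose Suc p"
    using gbinomial_poly by blast
  have "degree (P + smult (c p) R) \<le> Suc p"
    using P(1) R(1) by (intro degree_add_le) auto
  then show ?case using P(2) R(2) by (intro exI[of _ "P + smult (c p) R"]) auto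
qed (intro exI[of _ 0], simp)

text \<open>
  The solution is the pointwise limit of \<open>sum_approx p g\<close>, extended by \<open>0\<close> to the nonpositive reals.
  For its convexity, fix \<open>p + 2\<close> nodes: up to the polynomial part, which they annihilate, the divided
  difference of each approximant is a sum of divided differences of \<open>- g\<close> over translated nodes.
\<close>

lemma difference_equation_exists:
  assumes "g \<in> D_class p \<inter> K_class (int p)"
  shows "\<exists>f\<in>K_class (int p). (\<forall>x>0. fwd_diff f x = g x) \<and> f 1 = 0 \<and> (\<forall>x\<le>0. f x = 0)"
proof -
  have g0: "(\<lambda>n. (fwd_diff ^^ p) g (real n)) \<longlonglongrightarrow> 0" and gD: "g \<in> D_class (Suc p)"
    using assms D_class_mono[of p "Suc p"] by (auto simp: D_class_def)
  define F where "F = sum_approx p g"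
  have conv: "convergent (\<lambda>n. F n x)" if "x > 0" for x
  proof -
    have "summable (\<lambda>n. newton_rem (Suc p) g (real n) x)"
      using newton_rem_summable assms that by blast
    then have "summable (\<lambda>n. - newton_rem (Suc p) g (real (Suc n)) x)"
      by (intro summable_minus) (rule iffD2[OF summable_Suc_iff])
    then have "summable (\<lambda>n. F (Suc (Suc n)) x - F (Suc n) x)"
      by (simp add: F_def sum_approx_Suc)
    then have "convergent (\<lambda>n. \<Sum>i<n. F (Suc (Suc i)) x - F (Suc i) x)"
      by (simp add: summable_iff_convergent)
    then have "convergent (\<lambda>n. F (Suc n) x - F 1 x)"
      by (simp only: sum_lessThan_telescope[of "\<lambda>n. F (Suc n) x"] One_nat_def)
    then show ?thesis

      by (simp add: convergent_diff_const_right_iff convergent_Suc_iff[of "\<lambda>n. F n x"])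
  qed
  define f where "f = (\<lambda>x. if x > 0 then lim (\<lambda>n. F n x) else 0)"
  have f: "(\<lambda>n. F n x) \<longlonglongrightarrow> f x" if "x > 0" for x
    using conv[OF that] that by (simp add: f_def convergent_LIMSEQ_iff)
  have rem: "(\<lambda>n. newton_rem p g (real n) x) \<longlonglongrightarrow> 0" if "x > 0" for x
  proof -
    have "(\<lambda>n. newton_rem (Suc p) g (real n) x) \<longlonglongrightarrow> 0"
      using newton_rem_tendsto_0[of g p x] assms gD that by (simp add: D_class_def)
    then have "(\<lambda>n. newton_rem (Suc p) g (real n) x + (x gchoose p) * (fwd_diff ^^ p) g (real n))
        \<longlonglongrightarrow> 0 + (x gchoose p) * 0"
      by (intro tendsto_intros g0)
    then show ?thesis by (simp add: newton_rem_Suc)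
  qed
  have "fwd_diff f x = g x" if "x > 0" for x
  proof -
    have "(\<lambda>n. F n (x + 1) - F n x) \<longlonglongrightarrow> f (x + 1) - f x"
      using that by (intro tendsto_diff f) auto
    moreover have "(\<lambda>n. F n (x + 1) - F n x) \<longlonglongrightarrow> g x - 0"
      unfolding F_def sum_approx_step using that by (intro tendsto_intros rem)
    ultimately show ?thesis using LIMSEQ_unique by (simp add: fwd_diff_def) blast
  qed
  moreover have "f 1 = 0"
  proof -
    have "(\<lambda>n. if p = 0 then - g (real n) else 0) \<longlonglongrightarrow> 0"
      using tendsto_minus[OF g0] by (cases "p = 0") simp_all
    then have "(\<lambda>n. F n 1) \<longlonglongrightarrow> 0"
      unfolding F_def
      by (rule Lim_transform_eventually)
         (auto intro!: eventually_sequentiallyI[of 1] simp: sum_approx_1)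
    then show ?thesis using LIMSEQ_unique[OF f[of 1]] by simp
  qed
  moreover have "f \<in> K_class (int p)"
  proof -
    obtain M s where M: "M \<ge> 0" "s \<in> {1, -1}" "p_convex_on (int p) {M<..} (\<lambda>x. s * g x)"
      using IntD2[OF assms] unfolding K_class_iff by blast
    have "0 \<le> divdiff_on A (\<lambda>x. - s * f x)" if A: "finite A" "card A = Suc (Suc p)" "A \<subseteq> {M<..}" for A
    proof -
      have nonneg: "0 \<le> divdiff_on A (\<lambda>x. - s * F n x)" for n
      proof -
        define c where "c = (\<Sum>k=1..<n. g (real k))"
        obtain P :: "real poly" where P: "degree P \<le> p"
          "\<forall>x. poly P x = (\<Sum>j<p. (x gchoose Suc j) * (fwd_diff ^^ j) g (real n))"
          using gbinomial_sum_poly[of p "\<lambda>j. (fwd_diff ^^ j) g (real n)"] by blast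
        define Q where "Q = smult (- s) (P + [:c:])"
        have "degree Q \<le> p" unfolding Q_def using P(1) by (auto intro: degree_add_le)
        then have Q0: "divdiff_on A (poly Q) = 0" using divdiff_on_poly_eq_0 A by simp
        have "(\<lambda>x. - s * F n x) = (\<lambda>x. (\<Sum>k<n. s * g (x + real k)) + poly Q x)"
          using P(2)
          by (simp add: fun_eq_iff F_def sum_approx_def Q_def c_def sum_distrib_left [symmetric])
             (simp add: algebra_simps)
        then have "divdiff_on A (\<lambda>x. - s * F n x) = (\<Sum>k<n. divdiff_on A (\<lambda>x. s * g (x + real k)))"
          using Q0 by (simp add: divdiff_on_add divdiff_on_sum)
        also have "\<dots> = (\<Sum>k<n. divdiff_on ((\<lambda>x. x + real k) ` A) (\<lambda>x. s * g x))"
          using divdiff_on_shift[of A "\<lambda>x. s * g x"] by simp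
        also have "\<dots> \<ge> 0"
        proof (rule sum_nonneg)
          fix k
          have "(\<lambda>x. x + real k) ` A \<subseteq> {M<..}" using A(3) by force
          then show "0 \<le> divdiff_on ((\<lambda>x. x + real k) ` A) (\<lambda>x. s * g x)"
            using M(3) A unfolding p_convex_on_iff_divdiff_on by (simp add: card_image)
        qed
        finally show ?thesis .
      qed
      have "(\<lambda>n. divdiff_on A (\<lambda>x. - s * F n x)) \<longlonglongrightarrow> divdiff_on A (\<lambda>x. - s * f x)"
        unfolding divdiff_on_def
      proof (intro tendsto_sum tendsto_divide tendsto_mult tendsto_const f)
        fix a assume "a \<in> A"
        then show "a > 0" "(\<Prod>b\<in>A - {a}. a - b) \<noteq> 0" using A M(1) by auto
      qed
      then show ?thesis by (rule LIMSEQ_le_const) (use nonneg in auto)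
    qed
    then have "p_convex_on (int p) {M<..} (\<lambda>x. - s * f x)" unfolding p_convex_on_iff_divdiff_on by blast
    moreover have "- s \<in> {1, -1}" using M(2) by auto
    ultimately show ?thesis unfolding K_class_iff using M(1) by blast
  qed
  ultimately show ?thesis by (intro bexI[of _ f]) (auto simp: f_def)
qed

text \<open>
  The definite description ranges over all admissible orders. Two solutions that belong to different
  orders are compared at the smaller one: \<open>K\<^sup>p\<close> decreases in \<open>p\<close>, so both lie in the larger class,
  and \<open>g\<close> satisfies the decay condition there.
\<close>

lemma Sigma_op_solution:
  assumes "g \<in> D_class p \<inter> K_class (int p)"
  shows "Sigma_op g \<in> K_class (int p)" "\<forall>x>0. fwd_diff (Sigma_op g) x = g x" "Sigma_op g 1 = 0"
proof -
  define sol where "sol = (\<lambda>f. (\<exists>p::nat. g \<in> D_class p \<inter> K_class (int p) \<and> f \<in> K_class (int p)) \<and>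
     (\<forall>x>0. fwd_diff f x = g x) \<and> f 1 = 0 \<and> (\<forall>x\<le>0. f x = 0))"
  have uniq: "f1 = f2" if "sol f1" "sol f2" for f1 f2
  proof -
    obtain p1 p2 where p: "g \<in> D_class p1" "f1 \<in> K_class (int p1)" "g \<in> D_class p2" "f2 \<in> K_class (int p2)"
      using \<open>sol f1\<close> \<open>sol f2\<close> unfolding sol_def by blast
    have "g \<in> D_class (min p1 p2)" using p by (auto simp: min_def)
    moreover have "f1 \<in> K_class (int (min p1 p2))" "f2 \<in> K_class (int (min p1 p2))"
      using p K_class_antimono[of "min p1 p2"] by (meson min.cobounded1 min.cobounded2 subsetD)+
    ultimately have "f1 x - f2 x = f1 1 - f2 1" if "x > 0" for x
      using difference_equation_unique \<open>sol f1\<close> \<open>sol f2\<close> that unfolding sol_def by blast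
    then have "f1 x = f2 x" for x
      using \<open>sol f1\<close> \<open>sol f2\<close> unfolding sol_def by (cases "x > 0") auto
    then show ?thesis by auto
  qed
  obtain f where f: "f \<in> K_class (int p)" "\<forall>x>0. fwd_diff f x = g x" "f 1 = 0" "\<forall>x\<le>0. f x = 0"
    using difference_equation_exists[OF assms] by blast
  then have "sol f" unfolding sol_def using assms by blast
  then have "Sigma_op g = f"
    unfolding Sigma_op_def sol_def [symmetric] using uniq by (intro the_equality) auto
  then show "Sigma_op g \<in> K_class (int p)" "\<forall>x>0. fwd_diff (Sigma_op g) x = g x" "Sigma_op g 1 = 0"
    using f by auto
qed

section \<open>Iterated indefinite sums\<close>

text \<open>
  Summing raises the decay order by one and keeps the convexity order, since \<open>g\<close> may be regarded as
  an element of \<open>D\<^sup>r \<inter> K\<^sup>r\<close>.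
\<close>

lemma Sigma_op_in_classes:
  assumes "g \<in> D_class q \<inter> K_class (int r)" "q \<le> r"
  shows "Sigma_op g \<in> D_class (Suc q) \<inter> K_class (int r)"
    "\<forall>x>0. fwd_diff (Sigma_op g) x = g x" "Sigma_op g 1 = 0"
proof -
  have "g \<in> D_class r \<inter> K_class (int r)"
    using assms(1) D_class_mono[OF assms(2)] by blast
  note S = Sigma_op_solution[OF this]
  have "(\<lambda>n. (fwd_diff ^^ q) g (real n)) \<longlonglongrightarrow> 0" using assms by (simp add: D_class_def)
  then have "(\<lambda>n. (fwd_diff ^^ Suc q) (Sigma_op g) (real n)) \<longlonglongrightarrow> 0"
    unfolding fwd_diff_pow_Suc'
    by (rule Lim_transform_eventually)
       (use fwd_diff_pow_cong[OF S(2)] in \<open>auto intro!: eventually_sequentiallyI[of 1]\<close>)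
  then show "Sigma_op g \<in> D_class (Suc q) \<inter> K_class (int r)"
    using S(1) by (simp add: D_class_def)
  show "\<forall>x>0. fwd_diff (Sigma_op g) x = g x" "Sigma_op g 1 = 0" using S by auto
qed

lemma Sigma_op_pow_in_classes:
  assumes "g \<in> D_class q \<inter> K_class (int r)" "q + k \<le> Suc r"
  shows "(Sigma_op ^^ k) g \<in> D_class (q + k) \<inter> K_class (int r)"
  using assms(2)
proof (induction k)
  case 0
  then show ?case using assms(1) by simp
next
  case (Suc k)
  then show ?case using Sigma_op_in_classes(1)[of "(Sigma_op ^^ k) g" "q + k" r] by simp
qed

lemma fwd_diff_Sigma_op_pow:
  assumes "g \<in> D_class q \<inter> K_class (int r)" "q + (j + i) \<le> Suc r" "x > 0"
  shows "(fwd_diff ^^ j) ((Sigma_op ^^ (j + i)) g) x = (Sigma_op ^^ i) g x"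
  using assms(2)
proof (induction j)
  case (Suc j)
  have "(Sigma_op ^^ (j + i)) g \<in> D_class (q + (j + i)) \<inter> K_class (int r)"
    by (rule Sigma_op_pow_in_classes[OF assms(1)]) (use Suc.prems in simp)
  then have "\<forall>x>0. fwd_diff (Sigma_op ((Sigma_op ^^ (j + i)) g)) x = (Sigma_op ^^ (j + i)) g x"
    using Sigma_op_in_classes(2) Suc.prems by simp
  from fwd_diff_pow_cong[OF this, of j] Suc show ?case
    using assms(3) by (simp add: funpow_swap1)
qed simp

text \<open>
  Each summation adds one zero: \<open>\<Sigma>h\<close> vanishes at \<open>1\<close>, and its increments \<open>h\<close> vanish at \<open>1, \<dots>, k\<close>.
\<close>

lemma Sigma_op_pow_zeros:
  assumes "g \<in> D_class q \<inter> K_class (int r)" "q + k \<le> Suc r" "i < k"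
  shows "(Sigma_op ^^ k) g (real i + 1) = 0"
  using assms(2,3)
proof (induction k arbitrary: i)
  case (Suc k)
  define h where "h = (Sigma_op ^^ k) g"
  have "h \<in> D_class (q + k) \<inter> K_class (int r)"
    unfolding h_def by (rule Sigma_op_pow_in_classes[OF assms(1)]) (use Suc.prems in simp)
  note S = Sigma_op_in_classes(2,3)[OF this]
  note zeros = Suc.IH
  have "Sigma_op h (real i + 1) = 0" if "i < Suc k" for i
    using that
  proof (induction i)
    case 0
    then show ?case using S Suc.prems by simp
  next
    case (Suc i)
    have "fwd_diff (Sigma_op h) (real i + 1) = h (real i + 1)" using S \<open>q + Suc k \<le> Suc r\<close> by simp
    also have "\<dots> = 0"
      unfolding h_def using Suc.prems \<open>q + Suc k \<le> Suc r\<close> by (intro zeros) auto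
    finally show ?case using Suc by (simp add: fwd_diff_def add.commute)
  qed
  then show ?case using Suc.prems by (simp add: h_def)
qed simp

text \<open>
  A polynomial equals its Newton expansion at \<open>0\<close>, because its remainder is a multiple of a vanishing
  divided difference. In the binomial basis, antidifferences only shift the index.
\<close>

lemma poly_antidifference:
  fixes P :: "real poly"
  shows "\<exists>Q. degree Q \<le> Suc (degree P) \<and> (\<forall>x. poly Q (x + 1) - poly Q x = poly P x)"
proof -
  define d where "d = degree P"
  define c where "c = (\<lambda>j. (fwd_diff ^^ j) (poly P) 0)"
  obtain Q :: "real poly" where Q: "degree Q \<le> Suc d"
      "\<forall>x. poly Q x = (\<Sum>j<Suc d. (x gchoose Suc j) * c j)"
    using gbinomial_sum_poly[of "Suc d" c] by blast
  have "newton_rem (Suc d) (poly P) 0 x = 0" for x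
  proof (cases "x \<in> real ` {..<Suc d}")
    case True
    then show ?thesis using newton_rem_at_node by auto
  next
    case False
    have "card (insert (0 + x) (nodes (Suc d) 0)) = d + 2"
      using False mem_nodes_iff[of 0 x "Suc d"] by simp
    then have "divdiff_on (insert (0 + x) (nodes (Suc d) 0)) (poly P) = 0"
      by (intro divdiff_on_poly_eq_0) (auto simp: d_def)
    then show ?thesis using newton_rem_eq_divdiff_on[OF False] by simp
  qed
  then have "poly P x = (\<Sum>j<Suc d. (x gchoose j) * c j)" for x
    by (simp add: newton_rem_def c_def)
  then have "poly Q (x + 1) - poly Q x = poly P x" for x
    using Q(2) gbinomial_sum_fwd_diff[of x c "Suc d"] by (simp del: sum.lessThan_Suc)
  then show ?thesis using Q(1) d_def by blast
qed

text \<open>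
  Induction on \<open>m\<close>, applied to \<open>\<Delta>f\<close>. If \<open>\<Delta>f = P + h\<close> with \<open>h = \<Sigma>\<^sup>m g\<close> and \<open>\<Delta>Q = P\<close>, then \<open>f - Q\<close> is a
  solution of \<open>\<Delta>F = h\<close>, still in \<open>K\<^sup>r\<close> since \<open>Q\<close> has degree at most \<open>r\<close>, and uniqueness applies.
\<close>

lemma iterated_difference_equation_solution:
  assumes "g \<in> D_class q \<inter> K_class (int r)" "q + m \<le> r"
    and "\<forall>x>0. (fwd_diff ^^ Suc m) f x = g x"
    and "\<forall>k\<le>m. (fwd_diff ^^ k) f \<in> K_class (int r)"
  shows "\<exists>P. degree P \<le> m \<and> (\<forall>x>0. f x = poly P x + (Sigma_op ^^ Suc m) g x)"
  using assms(2-)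
proof (induction m arbitrary: f)
  case 0
  have g: "g \<in> D_class r" "g \<in> K_class (int r)"
    using assms(1) D_class_mono[of q r] 0 by auto
  note S = Sigma_op_solution[OF IntI[OF g]]
  have f: "f \<in> K_class (int r)" "\<forall>x>0. fwd_diff f x = g x" using 0 by simp_all
  have "f x = poly [:f 1:] x + (Sigma_op ^^ Suc 0) g x" if "x > 0" for x
    using difference_equation_unique[OF g(1) f(1) S(1) f(2) S(2) that] S(3) by simp
  moreover have "degree [:f 1:] \<le> 0" by simp
  ultimately show ?case by blast
next
  case (Suc m)
  define h where "h = (Sigma_op ^^ Suc m) g"
  have "\<exists>P. degree P \<le> m \<and> (\<forall>x>0. fwd_diff f x = poly P x + h x)"
    unfolding h_def
  proof (rule Suc.IH)
    show "\<forall>k\<le>m. (fwd_diff ^^ k) (fwd_diff f) \<in> K_class (int r)"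
      using Suc.prems(3) unfolding fwd_diff_pow_Suc' [symmetric] by blast
  qed (use Suc.prems in \<open>simp_all add: funpow_swap1\<close>)
  then obtain P where P: "degree P \<le> m" "\<forall>x>0. fwd_diff f x = poly P x + h x" by blast
  obtain Q where Q: "degree Q \<le> Suc m" "\<forall>x. poly Q (x + 1) - poly Q x = poly P x"
    using poly_antidifference[of P] P(1) by (meson Suc_le_mono order_trans)
  have "h \<in> D_class (q + Suc m) \<inter> K_class (int r)"
    unfolding h_def using Suc.prems assms(1) by (intro Sigma_op_pow_in_classes) auto
  then have h: "h \<in> D_class r" "h \<in> K_class (int r)"
    using D_class_mono[OF Suc.prems(1)] by blast+
  note S = Sigma_op_solution[OF IntI[OF h]]
  define F where "F = (\<lambda>x. f x + poly (- Q) x)"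
  have "(fwd_diff ^^ 0) f \<in> K_class (int r)" using Suc.prems(3) by blast
  then have FK: "F \<in> K_class (int r)"
    unfolding F_def using Q(1) Suc.prems(1) by (intro K_class_add_poly) auto
  have FD: "\<forall>x>0. fwd_diff F x = h x"
    using P(2) Q(2) by (auto simp: fwd_diff_def F_def algebra_simps)
  have "f x = poly (Q + [:F 1:]) x + (Sigma_op ^^ Suc (Suc m)) g x" if "x > 0" for x
  proof -
    have "F x = F 1 + Sigma_op h x"
      using difference_equation_unique[OF h(1) FK S(1) FD S(2) that] S(3) by simp
    moreover have "f x = F x + poly Q x" by (simp add: F_def)
    ultimately show ?thesis by (simp add: h_def)
  qed
  moreover have "degree (Q + [:F 1:]) \<le> Suc m" using Q(1) by (intro degree_add_le) auto
  ultimately show ?case by blast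
qed

lemma poly_plus_Sigma_op_in_K_class:
  assumes "g \<in> D_class q \<inter> K_class (int r)" "q + m \<le> r" "degree P \<le> m" "k \<le> m"
    and f: "\<forall>x>0. f x = poly P x + (Sigma_op ^^ Suc m) g x"
  shows "(fwd_diff ^^ k) f \<in> K_class (int r)"
proof -
  define i where "i = Suc m - k"
  have i: "Suc m = k + i" using assms by (simp add: i_def)
  obtain Q where Q: "degree Q \<le> degree P" "(fwd_diff ^^ k) (poly P) = poly Q"
    using fwd_diff_pow_poly by blast
  have "(Sigma_op ^^ i) g \<in> K_class (int r)"
    using Sigma_op_pow_in_classes[OF assms(1), of i] assms i by simp
  then have "(\<lambda>x. (Sigma_op ^^ i) g x + poly Q x) \<in> K_class (int r)"
    using Q assms by (intro K_class_add_poly) auto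
  moreover have "\<forall>x>0. (fwd_diff ^^ k) f x = (Sigma_op ^^ i) g x + poly Q x"
  proof (intro allI impI)
    fix x :: real assume "x > 0"
    have "(fwd_diff ^^ k) f x
        = (fwd_diff ^^ k) (\<lambda>x. poly P x + (Sigma_op ^^ Suc m) g x) x"
      using fwd_diff_pow_cong[OF f, of k] \<open>x > 0\<close> by blast
    also have "\<dots> = poly Q x + (Sigma_op ^^ i) g x"
      unfolding fwd_diff_pow_plus Q(2) i
      using fwd_diff_Sigma_op_pow[OF assms(1), of k i x] assms(2) \<open>x > 0\<close> i by simp
    finally show "(fwd_diff ^^ k) f x = (Sigma_op ^^ i) g x + poly Q x" by simp
  qed
  ultimately show ?thesis by (simp only: K_class_cong)
qed

theorem proposition4p2:
  fixes p m :: nat and g :: "real \<Rightarrow> real"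
  assumes "g \<in> D_class p \<inter> K_class (int (p + m))"
  shows "(\<forall>f :: real \<Rightarrow> real. (\<forall>x>0. (fwd_diff ^^ (m + 1)) f x = g x) \<longrightarrow>
            ((\<forall>k\<in>{0..m}. (fwd_diff ^^ k) f \<in> K_class (int (p + m))) \<longleftrightarrow>
             (\<exists>P :: real poly. degree P \<le> m \<and>
                (\<forall>x>0. f x = poly P x + (Sigma_op ^^ (m + 1)) g x)))) \<and>
         (\<forall>f :: real \<Rightarrow> real.
            ((\<forall>x>0. (fwd_diff ^^ (m + 1)) f x = g x) \<and>
             (\<forall>k\<in>{0..m}. (fwd_diff ^^ k) f \<in> K_class (int (p + m)) \<and> f (real k + 1) = 0)) \<longleftrightarrow>
            (\<forall>x>0. f x = (Sigma_op ^^ (m + 1)) g x))"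
proof -
  define S where "S = (Sigma_op ^^ (m + 1)) g"
  have S_Suc: "(Sigma_op ^^ Suc m) g = S" by (simp add: S_def)
  have zeros: "S (real k + 1) = 0" if "k \<le> m" for k
    unfolding S_def using that by (intro Sigma_op_pow_zeros[OF assms]) auto
  have eqS: "(fwd_diff ^^ (m + 1)) S x = g x" if "x > 0" for x
    using fwd_diff_Sigma_op_pow[OF assms, of "m + 1" 0 x] that by (simp add: S_def)
  have form: "\<exists>P. degree P \<le> m \<and> (\<forall>x>0. f x = poly P x + S x)"
    if "\<forall>x>0. (fwd_diff ^^ (m + 1)) f x = g x" "\<forall>k\<in>{0..m}. (fwd_diff ^^ k) f \<in> K_class (int (p + m))"
    for f
    using iterated_difference_equation_solution[OF assms, of m f] that unfolding S_Suc by simp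
  have K: "(fwd_diff ^^ k) f \<in> K_class (int (p + m))"
    if "degree P \<le> m" "\<forall>x>0. f x = poly P x + S x" "k \<in> {0..m}" for f P k
    using poly_plus_Sigma_op_in_K_class[OF assms, of m P k f] that unfolding S_Suc by simp
  have uniq: "(\<forall>x>0. (fwd_diff ^^ (m + 1)) f x = g x) \<and>
        (\<forall>k\<in>{0..m}. (fwd_diff ^^ k) f \<in> K_class (int (p + m)) \<and> f (real k + 1) = 0) \<longleftrightarrow>
        (\<forall>x>0. f x = S x)" for f
  proof
    assume L: "(\<forall>x>0. (fwd_diff ^^ (m + 1)) f x = g x) \<and>
        (\<forall>k\<in>{0..m}. (fwd_diff ^^ k) f \<in> K_class (int (p + m)) \<and> f (real k + 1) = 0)"
    then obtain P where P: "degree P \<le> m" "\<forall>x>0. f x = poly P x + S x" using form by blast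
    have "poly P (real k + 1) = 0" if "k \<le> m" for k
    proof -
      have "f (real k + 1) = poly P (real k + 1) + S (real k + 1)" using P(2) by simp
      then show ?thesis using L zeros[OF that] that by simp
    qed
    then have sub: "(\<lambda>k. real k + 1) ` {..m} \<subseteq> {x. poly P x = 0}" by auto
    have "P = 0"
    proof (rule ccontr)
      assume "P \<noteq> 0"
      then have "card ((\<lambda>k. real k + 1) ` {..m}) \<le> card {x. poly P x = 0}"
        by (intro card_mono sub poly_roots_finite)
      also have "\<dots> \<le> degree P" using \<open>P \<noteq> 0\<close> by (rule card_poly_roots_bound)
      finally show False using P(1) by (simp add: card_image inj_on_def)
    qed
    then show "\<forall>x>0. f x = S x" using P(2) by simp
  next
    assume R: "\<forall>x>0. f x = S x"
    have "\<forall>x>0. (fwd_diff ^^ (m + 1)) f x = g x"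
      using fwd_diff_pow_cong[OF R, of "m + 1"] eqS by metis
    moreover have "(fwd_diff ^^ k) f \<in> K_class (int (p + m))" if "k \<in> {0..m}" for k
      using K[of 0 f k] R that by simp
    moreover have "f (real k + 1) = 0" if "k \<in> {0..m}" for k
      using R zeros[of k] that by simp
    ultimately show "(\<forall>x>0. (fwd_diff ^^ (m + 1)) f x = g x) \<and>
        (\<forall>k\<in>{0..m}. (fwd_diff ^^ k) f \<in> K_class (int (p + m)) \<and> f (real k + 1) = 0)" by blast
  qed
  show ?thesis
    unfolding S_def [symmetric]
  proof (intro conjI allI impI)
    fix f :: "real \<Rightarrow> real"
    assume f: "\<forall>x>0. (fwd_diff ^^ (m + 1)) f x = g x"
    show "(\<forall>k\<in>{0..m}. (fwd_diff ^^ k) f \<in> K_class (int (p + m))) \<longleftrightarrow>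
        (\<exists>P :: real poly. degree P \<le> m \<and> (\<forall>x>0. f x = poly P x + S x))"
    proof
      assume "\<forall>k\<in>{0..m}. (fwd_diff ^^ k) f \<in> K_class (int (p + m))"
      then show "\<exists>P :: real poly. degree P \<le> m \<and> (\<forall>x>0. f x = poly P x + S x)"
        by (rule form[OF f])
    next
      assume "\<exists>P :: real poly. degree P \<le> m \<and> (\<forall>x>0. f x = poly P x + S x)"
      then obtain P where "degree P \<le> m" "\<forall>x>0. f x = poly P x + S x" by blast
      then show "\<forall>k\<in>{0..m}. (fwd_diff ^^ k) f \<in> K_class (int (p + m))"
        by (intro ballI K)
    qed
  qed (rule uniq)
qed

end
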